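(* The region of the local stability for Model GL is a proper subset of that for Model GB. That is, $\Omega_{GL}\subsetneq\Omega_{GB}$, where $\Omega_{GL}$ and $\Omega_{GB}$ are the sets of parameters $(c_1,c_2,\delta)$ with $c_1,c_2,\delta>0$ for which the unique positive equilibrium of Model GL, respectively Model GB, is locally stable.
   Context: Parameters: $c_1,c_2,\delta>0$. For $x_1,x_2>0$, $$G_1(x_1,x_2)=\frac{x_1x_2}{(x_1+x_2)^2}-2c_1x_1^2 .$$ For $x_1>0$, $R_2(x_1)$ denotes the unique positive solution $x_2$ of the cubic equation $x_1-2c_2x_2(x_2+x_1)^2=0$. Model GL: $x_1(t+1)=x_1(t)+\delta G_1(x_1(t),x_2(t))$, $\;x_2(t+1)=\dfrac{2x_2(t)+x_1(t)}{2\left(1+c_2(x_1(t)+x_2(t))^2\right)}$. Model GB: $x_1(t+1)=x_1(t)+\delta G_1(x_1(t),x_2(t))$, $\;x_2(t+1)=R_2(x_1(t))$. Both models are two-dimensional maps with the same unique equilibrium (fixed point) with $x_1,x_2>0$: $$(x_1,x_2)=\left(\frac{\sqrt{c_2}}{\sqrt{c_1}+\sqrt{c_2}}\,\frac{1}{\sqrt{2\sqrt{c_1c_2}}},\ \frac{\sqrt{c_1}}{\sqrt{c_1}+\sqrt{c_2}}\,\frac{1}{\sqrt{2\sqrt{c_1c_2}}}\right).$$ Local stability is understood by the linearized criterion: all eigenvalues of the $2\times2$ Jacobian matrix of the map at the equilibrium lie in the open unit disk. *)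

theory Defs
  imports "HOL-Analysis.Analysis"
begin

definition G1 :: "real \<Rightarrow> real \<Rightarrow> real \<Rightarrow> real" where
  "G1 c1 x1 x2 = x1 * x2 / (x1 + x2)\<^sup>2 - 2 * c1 * x1\<^sup>2"

definition R2 :: "real \<Rightarrow> real \<Rightarrow> real" where
  "R2 c2 x1 = (THE x2. x2 > 0 \<and> x1 - 2 * c2 * x2 * (x2 + x1)\<^sup>2 = 0)"

(* The maps of the models are total functions on the plane; their values off the open positive
   quadrant carry no meaning and do not influence the derivative at a positive equilibrium. *)

definition GL_map :: "real \<Rightarrow> real \<Rightarrow> real \<Rightarrow> real^2 \<Rightarrow> real^2" where
  "GL_map c1 c2 \<delta> x = vector
     [x$1 + \<delta> * G1 c1 (x$1) (x$2),
      (2 * x$2 + x$1) / (2 * (1 + c2 * (x$1 + x$2)\<^sup>2))]"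

definition GB_map :: "real \<Rightarrow> real \<Rightarrow> real \<Rightarrow> real^2 \<Rightarrow> real^2" where
  "GB_map c1 c2 \<delta> x = vector
     [x$1 + \<delta> * G1 c1 (x$1) (x$2),
      R2 c2 (x$1)]"

definition positive_equilibrium :: "(real^2 \<Rightarrow> real^2) \<Rightarrow> real^2" where
  "positive_equilibrium f = (THE x. x$1 > 0 \<and> x$2 > 0 \<and> f x = x)"

definition eigenvalue :: "complex^'n^'n \<Rightarrow> complex \<Rightarrow> bool" where
  "eigenvalue A z \<longleftrightarrow> (\<exists>v. v \<noteq> 0 \<and> A *v v = z *s v)"

(* Differentiability is required explicitly because the library's jacobian is an arbitrary
   matrix at points where the map is not differentiable. The real Jacobian is regarded as a
   complex matrix so that non-real eigenvalues are taken into account. *)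

definition locally_stable_at :: "(real^'n \<Rightarrow> real^'n) \<Rightarrow> real^'n \<Rightarrow> bool" where
  "locally_stable_at f x \<longleftrightarrow>
     f differentiable (at x) \<and>
     (\<forall>z. eigenvalue (map_matrix complex_of_real (jacobian f (at x))) z \<longrightarrow> norm z < 1)"

definition Omega_GL :: "(real \<times> real \<times> real) set" where
  "Omega_GL = {(c1, c2, \<delta>). c1 > 0 \<and> c2 > 0 \<and> \<delta> > 0 \<and>
     locally_stable_at (GL_map c1 c2 \<delta>) (positive_equilibrium (GL_map c1 c2 \<delta>))}"

definition Omega_GB :: "(real \<times> real \<times> real) set" where
  "Omega_GB = {(c1, c2, \<delta>). c1 > 0 \<and> c2 > 0 \<and> \<delta> > 0 \<and>
     locally_stable_at (GB_map c1 c2 \<delta>) (positive_equilibrium (GB_map c1 c2 \<delta>))}"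

end

theory Submission
  imports Defs
begin

text \<open>
  Write the equilibrium as \<open>((1 - q) s, q s)\<close> with \<open>0 < q < 1\<close> and \<open>s > 0\<close>, and put \<open>k = \<delta> / s\<close>;
  then \<open>c1 = q / (2 (1 - q) s^2)\<close> and \<open>c2 = (1 - q) / (2 q s^2)\<close>, and both Jacobians depend only
  on \<open>q\<close> and \<open>k\<close>. The Jury condition that can fail first is positivity of the characteristic
  polynomial at \<open>-1\<close> (a period-doubling boundary). It reads \<open>k q (1 + 3q - 2q^2) < 1 + q + 2q^2\<close>
  for GL and \<open>k q (1 + 4q - 4q^2) < 1 + 2q\<close> for GB, and the inclusion follows from
  \<open>(1 + 2q)(1 + 3q - 2q^2) - (1 + q + 2q^2)(1 + 4q - 4q^2) = 2q^2 (1 - 2q)^2\<close>. Away from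
  \<open>q = 1/2\<close> there is a gap between the two bounds on \<open>k\<close>, which makes the inclusion proper.
\<close>

section \<open>Eigenvalues of 2x2 matrices and the Jury conditions\<close>

lemma eigenvalue_2x2:
  fixes A :: "complex^2^2"
  shows "eigenvalue A z \<longleftrightarrow> (z - A$1$1) * (z - A$2$2) = A$1$2 * A$2$1"
proof
  assume "eigenvalue A z"
  then obtain v where "v \<noteq> 0" and v: "A *v v = z *s v"
    unfolding eigenvalue_def by blast
  have 1: "A$1$1 * v$1 + A$1$2 * v$2 = z * v$1" and 2: "A$2$1 * v$1 + A$2$2 * v$2 = z * v$2"
    using arg_cong[OF v, of "\<lambda>w. w$1"] arg_cong[OF v, of "\<lambda>w. w$2"]
    by (simp_all add: matrix_vector_mult_def sum_2)
  have "((z - A$1$1) * (z - A$2$2) - A$1$2 * A$2$1) * v$1 = 0"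
    using 1 2 by algebra
  moreover have "((z - A$1$1) * (z - A$2$2) - A$1$2 * A$2$1) * v$2 = 0"
    using 1 2 by algebra
  moreover have "v$1 \<noteq> 0 \<or> v$2 \<noteq> 0"
    using \<open>v \<noteq> 0\<close> by (auto simp: vec_eq_iff forall_2)
  ultimately show "(z - A$1$1) * (z - A$2$2) = A$1$2 * A$2$1" by auto
next
  assume char: "(z - A$1$1) * (z - A$2$2) = A$1$2 * A$2$1"
  have ev: "eigenvalue A z"
    if "(p, q) \<noteq> (0, 0)" "A$1$1 * p + A$1$2 * q = z * p" "A$2$1 * p + A$2$2 * q = z * q" for p q
    unfolding eigenvalue_def using that
    by (intro exI[of _ "vector [p, q]"])
      (auto simp: vec_eq_iff forall_2 matrix_vector_mult_def sum_2)
  \<comment> \<open>The first candidate eigenvector solves the first row of the eigenvector equation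
    identically, the second one the second row; \<open>char\<close> supplies the remaining row. Both
    vanish only if \<open>A\<close> is \<open>z\<close> times the identity, and then any nonzero
    vector serves.\<close>
  consider "(A$1$2, z - A$1$1) \<noteq> (0, 0)" | "(z - A$2$2, A$2$1) \<noteq> (0, 0)"
    | "A$1$2 = 0" "A$2$1 = 0" "z = A$1$1" "z = A$2$2" by fastforce
  then show "eigenvalue A z"
  proof cases
    case 1
    then show ?thesis by (rule ev) (use char in \<open>simp_all add: algebra_simps\<close>)
  next
    case 2
    then show ?thesis by (rule ev) (use char in \<open>simp_all add: algebra_simps\<close>)
  next
    case 3
    then show ?thesis by (intro ev[of 1 0]) auto
  qed
qed

lemma eigenvalue_of_real_2x2:
  fixes A :: "real^2^2"
  shows "eigenvalue (map_matrix complex_of_real A) z \<longleftrightarrow>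
    z\<^sup>2 - complex_of_real (A$1$1 + A$2$2) * z + complex_of_real (det A) = 0"
  unfolding eigenvalue_2x2 det_2
  by (auto simp: map_matrix_def algebra_simps power2_eq_square)

text \<open>The characteristic polynomial is monic, so a nonpositive value at -1 forces a real root
  at or below -1, which is an eigenvalue outside the open unit disk.\<close>

lemma stable_imp_charpoly_neg_one_pos:
  fixes A :: "real^2^2"
  assumes stable: "\<And>z. eigenvalue (map_matrix complex_of_real A) z \<Longrightarrow> norm z < 1"
  shows "1 + (A$1$1 + A$2$2) + det A > 0"
proof (rule ccontr)
  define t where "t = A$1$1 + A$2$2"
  define d where "d = det A"
  assume "\<not> ?thesis"
  then have neg: "1 + t + d \<le> 0" by (simp add: t_def d_def)
  define r where "r = (t - sqrt (t\<^sup>2 - 4 * d)) / 2"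
  \<comment> \<open>The right side exceeds the left by \<open>-4 * (1 + t + d)\<close>. This makes
    the root \<open>r\<close> real and at the same time places it at or below -1.\<close>
  have disc: "(t + 2)\<^sup>2 \<le> t\<^sup>2 - 4 * d"
    using neg by (simp add: power2_eq_square algebra_simps)
  then have "0 \<le> t\<^sup>2 - 4 * d" by (meson order_trans zero_le_power2)
  then have "(sqrt (t\<^sup>2 - 4 * d))\<^sup>2 = t\<^sup>2 - 4 * d" by simp
  then have root: "r\<^sup>2 - t * r + d = 0"
    by (simp add: r_def power2_eq_square field_simps)
  have "t + 2 \<le> sqrt (t\<^sup>2 - 4 * d)"
    using disc by (rule real_le_rsqrt)
  then have "r \<le> -1" by (simp add: r_def)
  moreover have "eigenvalue (map_matrix complex_of_real A) (complex_of_real r)"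
    using arg_cong[OF root, of complex_of_real]
    by (simp add: eigenvalue_of_real_2x2 t_def d_def)
  ultimately show False using stable[of "complex_of_real r"] by simp
qed

text \<open>Non-real eigenvalues are conjugate, so their squared modulus is the determinant. For
  real ones, positivity at 1 and at -1 puts both roots on the same side of each of these points, and
  the bound on the determinant excludes the outer sides.\<close>

lemma Jury_criterion_2x2:
  fixes A :: "real^2^2"
  assumes neg_one: "1 + (A$1$1 + A$2$2) + det A > 0"
    and one: "1 - (A$1$1 + A$2$2) + det A > 0"
    and det: "det A < 1"
    and ev: "eigenvalue (map_matrix complex_of_real A) z"
  shows "norm z < 1"
proof -
  define t where "t = A$1$1 + A$2$2"
  define d where "d = det A"
  have "z\<^sup>2 - complex_of_real t * z + complex_of_real d = 0"
    using ev by (simp add: eigenvalue_of_real_2x2 t_def d_def)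
  then have re: "(Re z)\<^sup>2 - (Im z)\<^sup>2 - t * Re z + d = 0" and im: "Im z * (2 * Re z - t) = 0"
    by (simp_all add: complex_eq_iff algebra_simps power2_eq_square)
  show ?thesis
  proof (cases "Im z = 0")
    case False
    then have "t = 2 * Re z" using im by simp
    then have "(norm z)\<^sup>2 = d"
      unfolding cmod_power2 using re by (simp add: power2_eq_square)
    then have "(norm z)\<^sup>2 < 1\<^sup>2" using det by (simp add: d_def)
    then show ?thesis by (rule power_less_imp_less_base) simp
  next
    case True
    define r where "r = Re z"
    have root: "r * r - t * r + d = 0"
      using re True by (simp add: r_def power2_eq_square)
    have p: "1 + t + d > 0" "1 - t + d > 0" "d < 1"
      using neg_one one det by (simp_all add: t_def d_def)
    have "r < 1"
    proof (rule ccontr)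
      assume "\<not> r < 1"
      \<comment> \<open>The other root is \<open>t - r\<close>. If \<open>r\<close> were at least 1,
        the sign of the product would push \<open>t - r\<close> above 1, hence \<open>t > 2\<close>,
        whereas \<open>t < 1 + d < 2\<close>.\<close>
      moreover have "(r - 1) * (r + 1 - t) = - (1 - t + d)"
        using root by algebra
      then have "(r - 1) * (r + 1 - t) < 0" using p by linarith
      ultimately have "r + 1 - t < 0" by (simp add: mult_less_0_iff)
      then show False using p \<open>\<not> r < 1\<close> by linarith
    qed
    moreover have "r > -1"
    proof (rule ccontr)
      assume "\<not> r > -1"
      moreover have "(r + 1) * (r - 1 - t) = - (1 + t + d)"
        using root by algebra
      then have "(r + 1) * (r - 1 - t) < 0" using p by linarith
      ultimately have "r - 1 - t > 0" by (simp add: mult_less_0_iff)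
      then show False using p \<open>\<not> r > -1\<close> by linarith
    qed
    ultimately show ?thesis using True by (simp add: cmod_eq_Re r_def abs_less_iff)
  qed
qed

section \<open>Jacobians of planar maps from their components\<close>

lemma vector_2_eq_iff: "vector [p, q] = (x :: 'a::zero^2) \<longleftrightarrow> p = x$1 \<and> q = x$2"
  by (simp add: vec_eq_iff forall_2)

lemma vec_nth_has_derivative: "((\<lambda>x :: real^'n. x$i) has_derivative (\<lambda>h. h$i)) F"
  by (rule bounded_linear_imp_has_derivative) (rule bounded_linear_vec_nth)

lemma jacobian_vector_2:
  fixes f1 f2 :: "real^2 \<Rightarrow> real"
  assumes 1: "(f1 has_derivative (\<lambda>h. a * h$1 + b * h$2)) (at x)"
    and 2: "(f2 has_derivative (\<lambda>h. c * h$1 + d * h$2)) (at x)"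
  shows "(\<lambda>x. vector [f1 x, f2 x] :: real^2) differentiable at x" (is "?f differentiable _")
    and "jacobian (\<lambda>x. vector [f1 x, f2 x] :: real^2) (at x) = vector [vector [a, b], vector [c, d]]"
proof -
  have vec: "vector [p, q] = p *\<^sub>R axis 1 1 + q *\<^sub>R (axis 2 1 :: real^2)" for p q :: real
    by (simp add: vec_eq_iff forall_2 axis_def)
  have der: "(?f has_derivative (\<lambda>h. vector [a * h$1 + b * h$2, c * h$1 + d * h$2])) (at x)"
    unfolding vec by (intro has_derivative_add has_derivative_scaleR_left 1 2)
  then show "?f differentiable at x" by (rule differentiableI)
  show "jacobian ?f (at x) = vector [vector [a, b], vector [c, d]]"
    unfolding jacobian_def frechet_derivative_at[OF der, symmetric]
    by (simp add: vec_eq_iff forall_2 matrix_def axis_def)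
qed

section \<open>The cubic response \<open>R2\<close> and its derivative\<close>

text \<open>Existence is the intermediate value theorem; uniqueness holds because the cubic term
  increases strictly in \<open>y > 0\<close>.\<close>

lemma cubic_root_ex1:
  fixes x c :: real
  assumes "x > 0" "c > 0"
  shows "\<exists>!y. y > 0 \<and> x - 2 * c * y * (y + x)\<^sup>2 = 0"
proof (rule ex_ex1I)
  define h where "h y = 2 * c * y * (y + x)\<^sup>2" for y
  \<comment> \<open>Chosen so that \<open>2 * c * m * x^2 = x\<close>; replacing \<open>x\<close> by
    \<open>m + x\<close> in the square only increases the value, so \<open>h\<close> reaches
    \<open>x\<close> on the interval from 0 to \<open>m\<close>.\<close>
  define m where "m = 1 / (2 * c * x)"
  have m: "m > 0" using assms by (simp add: m_def)
  have "x = 2 * c * m * x\<^sup>2"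
    using assms by (simp add: m_def field_simps power2_eq_square)
  also have "\<dots> \<le> h m"
    unfolding h_def using m assms by (intro mult_left_mono power_mono) auto
  finally have "x \<le> h m" .
  moreover have "h 0 \<le> x" using assms by (simp add: h_def)
  moreover have "continuous_on {0..m} h" unfolding h_def by (intro continuous_intros)
  ultimately obtain y where "0 \<le> y" "y \<le> m" "h y = x"
    using IVT'[of h 0 x m] m by auto
  moreover have "y \<noteq> 0" using \<open>h y = x\<close> assms by (auto simp: h_def)
  ultimately show "\<exists>y. y > 0 \<and> x - 2 * c * y * (y + x)\<^sup>2 = 0"
    by (auto simp: h_def intro!: exI[of _ y])
next
  fix y z
  assume y: "y > 0 \<and> x - 2 * c * y * (y + x)\<^sup>2 = 0" and z: "z > 0 \<and> x - 2 * c * z * (z + x)\<^sup>2 = 0"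
  have less: "2 * c * y * (y + x)\<^sup>2 < 2 * c * z * (z + x)\<^sup>2" if "0 < y" "y < z" for y z
  proof (rule mult_strict_mono)
    show "2 * c * y < 2 * c * z" "(y + x)\<^sup>2 < (z + x)\<^sup>2"
      using that assms by (auto intro!: power_strict_mono)
  qed (use that assms in auto)
  show "y = z"
    using less[of y z] less[of z y] y z by (cases y z rule: linorder_cases) auto
qed

lemma
  assumes "x > 0" "c > 0"
  shows R2_pos: "R2 c x > 0"
    and R2_cubic: "x = 2 * c * R2 c x * (R2 c x + x)\<^sup>2"
  using theI'[OF cubic_root_ex1[OF assms]] by (simp_all add: R2_def)

lemma R2_eq_iff:
  assumes "x > 0" "c > 0" "y > 0"
  shows "R2 c x = y \<longleftrightarrow> x = 2 * c * y * (y + x)\<^sup>2"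
  using cubic_root_ex1[OF assms(1,2)] R2_pos[OF assms(1,2)] R2_cubic[OF assms(1,2)] assms(3) by auto

text \<open>
  Subtracting the cubic equations at two points gives an exact formula for the difference quotient
  of \<open>R2\<close>, from which first a Lipschitz bound and then the derivative can be read off.
\<close>

lemma R2_diff:
  assumes "x > 0" "y > 0" "c > 0"
  defines "T \<equiv> (R2 c y + y) + (R2 c x + x)"
  shows "R2 c y - R2 c x =
    (1 - 2 * c * R2 c x * T) / (2 * c * ((R2 c y + y)\<^sup>2 + R2 c x * T)) * (y - x)"
proof -
  have pos: "R2 c x > 0" "R2 c y > 0" using R2_pos assms by auto
  have "2 * c * ((R2 c y + y)\<^sup>2 + R2 c x * T) > 0"
    unfolding T_def using pos assms by (intro mult_pos_pos add_pos_pos zero_less_power) auto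
  moreover have "(R2 c y - R2 c x) * (2 * c * ((R2 c y + y)\<^sup>2 + R2 c x * T)) -
      (1 - 2 * c * R2 c x * T) * (y - x) =
      2 * c * R2 c y * (R2 c y + y)\<^sup>2 - y - (2 * c * R2 c x * (R2 c x + x)\<^sup>2 - x)"
    unfolding T_def by algebra
  then have "(R2 c y - R2 c x) * (2 * c * ((R2 c y + y)\<^sup>2 + R2 c x * T)) =
      (1 - 2 * c * R2 c x * T) * (y - x)"
    using R2_cubic[OF assms(1,3)] R2_cubic[OF assms(2,3)] by linarith
  ultimately show ?thesis by (simp add: field_simps)
qed

lemma R2_diff_le:
  assumes "x > 0" "y > 0" "c > 0"
  shows "\<bar>R2 c y - R2 c x\<bar> \<le> (1 / (2 * c * R2 c x * x) + 1) * \<bar>y - x\<bar>"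
proof -
  define T where "T = (R2 c y + y) + (R2 c x + x)"
  define D where "D = 2 * c * ((R2 c y + y)\<^sup>2 + R2 c x * T)"
  have pos: "R2 c x > 0" "R2 c y > 0" using R2_pos assms by auto
  have T: "T \<ge> x" unfolding T_def using pos assms by simp
  then have DT: "D \<ge> 2 * c * R2 c x * T"
    using pos assms by (simp add: D_def algebra_simps)
  have Dx: "2 * c * R2 c x * T \<ge> 2 * c * R2 c x * x"
    using T pos assms by (intro mult_left_mono) auto
  have px: "2 * c * R2 c x * x > 0" using pos assms by simp
  have D: "D > 0" using DT Dx px by linarith
  \<comment> \<open>The subtracted term is positive and at most \<open>D\<close>. The bound
    \<open>1 / D + 1\<close> is then made independent of \<open>y\<close> through
    \<open>T \<ge> x\<close>.\<close>
  have "\<bar>1 - 2 * c * R2 c x * T\<bar> / D \<le> (1 + D) / D"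
  proof (rule divide_right_mono)
    show "\<bar>1 - 2 * c * R2 c x * T\<bar> \<le> 1 + D" using DT Dx px by linarith
  qed (use D in simp)
  also have "\<dots> = 1 / D + 1" using D by (simp add: field_simps)
  also have "\<dots> \<le> 1 / (2 * c * R2 c x * x) + 1"
  proof (intro add_right_mono divide_left_mono)
    show "2 * c * R2 c x * x \<le> D" using DT Dx by linarith
    show "0 < D * (2 * c * R2 c x * x)" using D px by (rule mult_pos_pos)
  qed simp
  finally have "\<bar>(1 - 2 * c * R2 c x * T) / D\<bar> \<le> 1 / (2 * c * R2 c x * x) + 1"
    using D by (simp add: abs_divide)
  then show ?thesis
    unfolding R2_diff[OF assms] abs_mult T_def[symmetric] D_def[symmetric]
    by (rule mult_right_mono) simp
qed

text \<open>The value is the one that implicit differentiation of the cubic gives. It is the limit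
  of the exact difference quotient, once the Lipschitz bound has shown that \<open>R2 c\<close> is
  continuous at \<open>x\<close>.\<close>

lemma R2_has_field_derivative:
  assumes "x > 0" "c > 0"
  defines "S \<equiv> R2 c x + x"
  shows "(R2 c has_field_derivative
    (1 - 4 * c * R2 c x * S) / (2 * c * (S\<^sup>2 + 2 * R2 c x * S))) (at x)"
proof -
  have near: "eventually (\<lambda>y. y > 0) (at x)"
    using assms(1) by (auto simp: eventually_at_topological intro!: exI[of _ "{0<..}"])
  have "((\<lambda>y. R2 c y - R2 c x) \<longlongrightarrow> 0) (at x)"
  proof (rule Lim_null_comparison)
    show "eventually (\<lambda>y. norm (R2 c y - R2 c x) \<le> (1 / (2 * c * R2 c x * x) + 1) * \<bar>y - x\<bar>) (at x)"
      using near by eventually_elim (simp only: real_norm_def R2_diff_le assms)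
    have "((\<lambda>y. (1 / (2 * c * R2 c x * x) + 1) * \<bar>y - x\<bar>) \<longlongrightarrow>
        (1 / (2 * c * R2 c x * x) + 1) * \<bar>x - x\<bar>) (at x)"
      by (intro tendsto_intros)
    then show "((\<lambda>y. (1 / (2 * c * R2 c x * x) + 1) * \<bar>y - x\<bar>) \<longlongrightarrow> 0) (at x)"
      by simp
  qed
  then have cont: "(R2 c \<longlongrightarrow> R2 c x) (at x)" by (simp add: LIM_zero_cancel)
  have pos: "R2 c x > 0" "S > 0" using R2_pos[of x c] assms by (auto simp: S_def)
  have "((\<lambda>y. (1 - 2 * c * R2 c x * ((R2 c y + y) + S)) /
      (2 * c * ((R2 c y + y)\<^sup>2 + R2 c x * ((R2 c y + y) + S)))) \<longlongrightarrow>
      (1 - 2 * c * R2 c x * ((R2 c x + x) + S)) /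
      (2 * c * ((R2 c x + x)\<^sup>2 + R2 c x * ((R2 c x + x) + S)))) (at x)"
  proof (intro tendsto_intros cont)
    have "(R2 c x + x)\<^sup>2 + R2 c x * ((R2 c x + x) + S) > 0"
      using pos by (simp add: S_def[symmetric] add_pos_pos)
    then show "2 * c * ((R2 c x + x)\<^sup>2 + R2 c x * ((R2 c x + x) + S)) \<noteq> 0"
      using assms by simp
  qed
  also have "(1 - 2 * c * R2 c x * ((R2 c x + x) + S)) /
      (2 * c * ((R2 c x + x)\<^sup>2 + R2 c x * ((R2 c x + x) + S))) =
      (1 - 4 * c * R2 c x * S) / (2 * c * (S\<^sup>2 + 2 * R2 c x * S))"
    unfolding S_def[symmetric] by (simp add: algebra_simps)
  finally have lim: "((\<lambda>y. (1 - 2 * c * R2 c x * ((R2 c y + y) + S)) /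
      (2 * c * ((R2 c y + y)\<^sup>2 + R2 c x * ((R2 c y + y) + S)))) \<longlongrightarrow>
      (1 - 4 * c * R2 c x * S) / (2 * c * (S\<^sup>2 + 2 * R2 c x * S))) (at x)" .
  have "eventually (\<lambda>y. (1 - 2 * c * R2 c x * ((R2 c y + y) + S)) /
      (2 * c * ((R2 c y + y)\<^sup>2 + R2 c x * ((R2 c y + y) + S))) =
      (R2 c y - R2 c x) / (y - x)) (at x)"
    using near eventually_neq_at_within[of x]
    by eventually_elim (use R2_diff[OF assms(1) _ assms(2)] in \<open>simp add: S_def\<close>)
  from Lim_transform_eventually[OF lim this] show ?thesis
    by (simp add: has_field_derivative_iff)
qed

section \<open>The common equilibrium of the two models\<close>

text \<open>The fixed point equations of both models, cleared of denominators and of the trivial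
  factor \<open>u\<close> in \<open>G1\<close>. In this form they are symmetric under exchanging
  \<open>(c1, u)\<close> with \<open>(c2, v)\<close>.\<close>

definition equilibrium_equations :: "real \<Rightarrow> real \<Rightarrow> real \<Rightarrow> real \<Rightarrow> bool" where
  "equilibrium_equations c1 c2 u v \<longleftrightarrow>
     u > 0 \<and> v > 0 \<and> v = 2 * c1 * u * (u + v)\<^sup>2 \<and> u = 2 * c2 * v * (u + v)\<^sup>2"

text \<open>Combining the two equations determines the fourth power of \<open>u + v\<close> and the
  square of the ratio of \<open>u\<close> to \<open>v\<close>; by positivity the sum and the ratio
  are themselves determined.\<close>

lemma equilibrium_equations_unique:
  assumes pos: "c1 > 0" "c2 > 0"
    and E: "equilibrium_equations c1 c2 u v" and E': "equilibrium_equations c1 c2 u' v'"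
  shows "u' = u \<and> v' = v"
proof -
  have char: "4 * c1 * c2 * ((u + v)\<^sup>2)\<^sup>2 = 1 \<and> c2 * v\<^sup>2 = c1 * u\<^sup>2"
    if "equilibrium_equations c1 c2 u v" for u v
  proof -
    have *: "u > 0" "v > 0" "v = 2 * c1 * u * (u + v)\<^sup>2" "u = 2 * c2 * v * (u + v)\<^sup>2"
      using that by (auto simp: equilibrium_equations_def)
    have "(4 * c1 * c2 * ((u + v)\<^sup>2)\<^sup>2 - 1) * u = 0" using *(3,4) by algebra
    moreover have "(c2 * v\<^sup>2 - c1 * u\<^sup>2) * (u + v)\<^sup>2 = 0" using *(3,4) by algebra
    ultimately show ?thesis using * by simp
  qed
  have p: "u > 0" "v > 0" "u' > 0" "v' > 0"
    using E E' by (auto simp: equilibrium_equations_def)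
  have "((u' + v')\<^sup>2)\<^sup>2 = ((u + v)\<^sup>2)\<^sup>2"
    using char[OF E] char[OF E'] pos by (metis less_irrefl mult_cancel_left mult_pos_pos zero_less_numeral)
  then have "(u' + v')\<^sup>2 = (u + v)\<^sup>2"
    by (rule power2_eq_imp_eq) simp_all
  then have S: "u' + v' = u + v"
    by (rule power2_eq_imp_eq) (use p in simp_all)
  have "c1 * c2 * (u' * v)\<^sup>2 = c1 * c2 * (u * v')\<^sup>2"
    using char[OF E] char[OF E'] by algebra
  then have "u' * v = u * v'" using p pos by (simp add: power2_eq_iff_nonneg)
  then have "u' * (u + v) = u * (u + v)" using S by algebra
  then show ?thesis using S p by simp
qed

text \<open>Here \<open>s\<close> is the sum of the equilibrium coordinates and \<open>q\<close> the
  share of the second one, read off from the closed form of the equilibrium. These parameters remove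
  all square roots from the later computations.\<close>

lemma equilibrium_equations_parametrization:
  fixes c1 c2 :: real
  assumes pos: "c1 > 0" "c2 > 0"
  obtains q s where "0 < q" "q < 1" "0 < s"
    "c1 = q / (2 * (1 - q) * s\<^sup>2)" "c2 = (1 - q) / (2 * q * s\<^sup>2)"
proof -
  define a where "a = sqrt c1"
  define b where "b = sqrt c2"
  have ab: "a > 0" "b > 0" "c1 = a\<^sup>2" "c2 = b\<^sup>2"
    using pos by (auto simp: a_def b_def)
  define q where "q = a / (a + b)"
  have q: "1 - q = b / (a + b)" using ab by (simp add: q_def field_simps)
  define s where "s = 1 / sqrt (2 * a * b)"
  have s: "s\<^sup>2 = 1 / (2 * a * b)" using ab by (simp add: s_def power_divide)
  show thesis
  proof
    show "0 < q" "q < 1" "0 < s" using ab by (auto simp: q_def s_def)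
    show "c1 = q / (2 * (1 - q) * s\<^sup>2)" "c2 = (1 - q) / (2 * q * s\<^sup>2)"
      unfolding q s unfolding q_def using ab by (auto simp: field_simps power2_eq_square)
  qed
qed

locale equilibrium =
  fixes c1 c2 q s \<delta> :: real
  assumes q: "0 < q" "q < 1" and s: "0 < s" and \<delta>: "0 < \<delta>"
    and c1: "c1 = q / (2 * (1 - q) * s\<^sup>2)" and c2: "c2 = (1 - q) / (2 * q * s\<^sup>2)"
begin

definition E :: "real^2" where "E = vector [(1 - q) * s, q * s]"

lemma E_nth [simp]: "E$1 = (1 - q) * s" "E$2 = q * s"
  by (simp_all add: E_def)

lemma E_sum: "(1 - q) * s + q * s = s" "q * s + (1 - q) * s = s"
  by (simp_all add: algebra_simps)

lemma c_pos: "c1 > 0" "c2 > 0"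
  using q s by (simp_all add: c1 c2)

text \<open>Division-free forms of \<open>c1\<close> and \<open>c2\<close>, used to eliminate both
  from the derivatives at \<open>E\<close>.\<close>

lemma c_s: "2 * c1 * (1 - q) * s\<^sup>2 = q" "2 * c2 * q * s\<^sup>2 = 1 - q"
proof -
  have "q \<noteq> 0" "1 - q \<noteq> 0" "s \<noteq> 0" using q s by auto
  then show "2 * c1 * (1 - q) * s\<^sup>2 = q" "2 * c2 * q * s\<^sup>2 = 1 - q"
    by (simp_all add: c1 c2 del: right_diff_distrib_numeral)
qed

lemma equations_iff:
  "equilibrium_equations c1 c2 (x$1) (x$2) \<longleftrightarrow> x = E"
proof -
  have "equilibrium_equations c1 c2 (E$1) (E$2)"
  proof -
    have "2 * c1 * ((1 - q) * s) * s\<^sup>2 = 2 * c1 * (1 - q) * s\<^sup>2 * s"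
      "2 * c2 * (q * s) * s\<^sup>2 = 2 * c2 * q * s\<^sup>2 * s" by simp_all
    then show ?thesis
      unfolding equilibrium_equations_def E_nth E_sum c_s using q s by simp
  qed
  moreover have "x = E" if "equilibrium_equations c1 c2 (x$1) (x$2)"
    using equilibrium_equations_unique[OF c_pos calculation that]
    by (simp only: vec_eq_iff forall_2 simp_thms)
  ultimately show ?thesis by metis
qed

lemma G1_eq_0_iff:
  assumes "u > 0" "v > 0"
  shows "G1 c1 u v = 0 \<longleftrightarrow> v = 2 * c1 * u * (u + v)\<^sup>2"
proof -
  have "(u + v)\<^sup>2 \<noteq> 0" using assms by simp
  then have "G1 c1 u v = 0 \<longleftrightarrow> u * v = 2 * c1 * u\<^sup>2 * (u + v)\<^sup>2"
    unfolding G1_def right_minus_eq by (rule nonzero_divide_eq_eq)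
  also have "\<dots> \<longleftrightarrow> u * v = u * (2 * c1 * u * (u + v)\<^sup>2)"
    by (simp add: power2_eq_square mult_ac)
  also have "\<dots> \<longleftrightarrow> v = 2 * c1 * u * (u + v)\<^sup>2" using assms by simp
  finally show ?thesis .
qed

text \<open>Clearing the denominator in the second component cancels \<open>2 * x$2\<close> and
  leaves the cubic that defines \<open>R2\<close>. Hence Model GL has the same positive fixed point
  as Model GB.\<close>

lemma GL_fixed_iff:
  assumes "x$1 > 0" "x$2 > 0"
  shows "GL_map c1 c2 \<delta> x = x \<longleftrightarrow> x = E"
proof -
  have "2 * (1 + c2 * (x$1 + x$2)\<^sup>2) > 0"
    using c_pos by (simp add: add_pos_nonneg)
  then have "(2 * x$2 + x$1) / (2 * (1 + c2 * (x$1 + x$2)\<^sup>2)) = x$2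
      \<longleftrightarrow> x$1 = 2 * c2 * x$2 * (x$1 + x$2)\<^sup>2"
    by (subst divide_eq_eq) (auto simp: algebra_simps)
  then show ?thesis
    using assms \<delta> G1_eq_0_iff[OF assms] equations_iff[of x]
    by (simp add: vector_2_eq_iff GL_map_def equilibrium_equations_def)
qed

lemma GB_fixed_iff:
  assumes "x$1 > 0" "x$2 > 0"
  shows "GB_map c1 c2 \<delta> x = x \<longleftrightarrow> x = E"
  using assms \<delta> G1_eq_0_iff[OF assms] equations_iff[of x] R2_eq_iff[OF assms(1) c_pos(2) assms(2)]
  by (simp add: vector_2_eq_iff GB_map_def equilibrium_equations_def add.commute)

lemma positive_equilibrium_eq:
  "positive_equilibrium (GL_map c1 c2 \<delta>) = E" "positive_equilibrium (GB_map c1 c2 \<delta>) = E"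
  unfolding positive_equilibrium_def
  by (rule the_equality; use GL_fixed_iff GB_fixed_iff q s in auto)+

abbreviation k where "k \<equiv> \<delta> / s"

section \<open>Jacobian entries at the equilibrium\<close>

lemma first_component_derivative:
  "((\<lambda>x. x$1 + \<delta> * G1 c1 (x$1) (x$2)) has_derivative
    (\<lambda>h. (1 - k * q * (3 - 2 * q)) * h$1 + k * (1 - q) * (1 - 2 * q) * h$2)) (at E)"
proof -
  have nz: "s \<noteq> 0" using s by simp
  have c1_x: "4 * (c1 * (a * ((1 - q) * s))) = 2 * a * q / s" for a
  proof -
    have "4 * (c1 * (a * ((1 - q) * s))) * s = 2 * a * (2 * c1 * (1 - q) * s\<^sup>2)" by algebra
    then show ?thesis unfolding c_s using nz by (simp add: nonzero_eq_divide_eq)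
  qed
  \<comment> \<open>The left side has the shape in which the differentiation rules and the
    simplifier leave the derivative, with \<open>c1\<close> already eliminated by
    \<open>c1_x\<close>.\<close>
  have eq: "a + \<delta> * (((1 - q) * s * b + a * (q * s)) / s\<^sup>2 -
      (1 - q) * s * (q * s) * (inverse (s\<^sup>2) * ((2 * a + 2 * b) * s) * inverse (s\<^sup>2)) -
      2 * a * q / s) =
      (1 - \<delta> * q * (3 - 2 * q) / s) * a + \<delta> * (1 - q) * (1 - 2 * q) * b / s" for a b
    using nz by (simp add: divide_simps) algebra
  show ?thesis
    unfolding G1_def
    by ((rule vec_nth_has_derivative derivative_eq_intros refl | simp add: nz E_sum)+,
        rule ext, simp add: E_sum c1_x eq)
qed

lemma GL_second_component_derivative:
  "((\<lambda>x. (2 * x$2 + x$1) / (2 * (1 + c2 * (x$1 + x$2)\<^sup>2))) has_derivative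
    (\<lambda>h. q * (2 * q - 1) / (1 + q) * h$1 + 2 * q\<^sup>2 / (1 + q) * h$2)) (at E)"
proof -
  have nz: "q \<noteq> 0" "1 + q \<noteq> 0" "s \<noteq> 0" using q s by auto
  \<comment> \<open>The denominator of the second component at \<open>E\<close>, where
    \<open>2 * c2 * s^2\<close> equals \<open>(1 - q) / q\<close>.\<close>
  have D: "2 + 2 * (c2 * s\<^sup>2) = (1 + q) / q"
    using nz c_s(2) by (simp add: nonzero_eq_divide_eq) algebra
  have eq: "(- (2 * (q * s)) - (1 - q) * s) * (q * (2 * (c2 * ((2 * a + 2 * b) * s))) * q) /
        ((1 + q) * (1 + q)) + (2 * b + a) * q / (1 + q) =
      q * (2 * q - 1) * a / (1 + q) + 2 * q\<^sup>2 * b / (1 + q)" for a b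
  proof -
    have "(- (2 * (q * s)) - (1 - q) * s) * (q * (2 * (c2 * ((2 * a + 2 * b) * s))) * q) =
        - 2 * q * (1 + q) * (a + b) * (2 * c2 * q * s\<^sup>2)" by algebra
    also have "\<dots> = - 2 * q * (1 + q) * (a + b) * (1 - q)" unfolding c_s ..
    finally have num: "(- (2 * (q * s)) - (1 - q) * s) * (q * (2 * (c2 * ((2 * a + 2 * b) * s))) * q) =
        - 2 * q * (1 + q) * (a + b) * (1 - q)" .
    show ?thesis
      unfolding num using nz by (simp add: divide_simps) algebra
  qed
  show ?thesis
    by ((rule vec_nth_has_derivative derivative_eq_intros refl | simp add: nz E_sum D)+,
        rule ext, simp add: E_sum D eq)
qed

text \<open>The response depends on the first coordinate alone; the summand \<open>0 * h$2\<close>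
  provides the shape that \<open>jacobian_vector_2\<close> expects.\<close>

lemma GB_second_component_derivative:
  "((\<lambda>x. R2 c2 (x$1)) has_derivative
    (\<lambda>h. q * (2 * q - 1) / ((1 - q) * (1 + 2 * q)) * h$1 + 0 * h$2)) (at E)"
proof -
  have pos: "(1 - q) * s > 0" "q * s > 0" using q s by auto
  have R2: "R2 c2 ((1 - q) * s) = q * s"
    unfolding R2_eq_iff[OF pos(1) c_pos(2) pos(2)] E_sum using c_s(2) by algebra
  have "(1 - 4 * c2 * (q * s) * s) / (2 * c2 * (s\<^sup>2 + 2 * (q * s) * s)) =
      q * (2 * q - 1) / ((1 - q) * (1 + 2 * q))"
  proof -
    have "4 * c2 * (q * s) * s = 2 * (1 - q)" "2 * c2 * (s\<^sup>2 + 2 * (q * s) * s) = (1 - q) * (1 + 2 * q) / q"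
    proof -
      show "4 * c2 * (q * s) * s = 2 * (1 - q)" using c_s(2) by algebra
      have "2 * c2 * (s\<^sup>2 + 2 * (q * s) * s) * q = (1 - q) * (1 + 2 * q)" using c_s(2) by algebra
      then show "2 * c2 * (s\<^sup>2 + 2 * (q * s) * s) = (1 - q) * (1 + 2 * q) / q"
        using q by (simp add: nonzero_eq_divide_eq)
    qed
    then show ?thesis by simp
  qed
  then have "(R2 c2 has_field_derivative q * (2 * q - 1) / ((1 - q) * (1 + 2 * q))) (at (E$1))"
    using R2_has_field_derivative[OF pos(1) c_pos(2)] by (simp add: R2 E_sum)
  then have "((\<lambda>x. R2 c2 (x$1)) has_derivative
      (\<lambda>h. (q * (2 * q - 1) / ((1 - q) * (1 + 2 * q))) * h$1)) (at E)"
    unfolding has_field_derivative_def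
    by (rule has_derivative_compose[rotated]) (rule vec_nth_has_derivative)
  then show ?thesis by simp
qed

lemmas GL_jacobian = jacobian_vector_2[OF first_component_derivative GL_second_component_derivative,
    folded GL_map_def]

lemmas GB_jacobian = jacobian_vector_2[OF first_component_derivative GB_second_component_derivative,
    folded GB_map_def]

section \<open>Stability bounds and their comparison\<close>

text \<open>For the inclusion a necessary condition on the GL side suffices, namely positivity of
  the characteristic polynomial at -1.\<close>

lemma GL_stable_imp:
  assumes "locally_stable_at (GL_map c1 c2 \<delta>) E"
  shows "k * q * (1 + 3 * q - 2 * q\<^sup>2) < 1 + q + 2 * q\<^sup>2"
proof -
  let ?J = "jacobian (GL_map c1 c2 \<delta>) (at E)"
  have "1 + (?J$1$1 + ?J$2$2) + det ?J > 0"
    using assms unfolding locally_stable_at_def by (intro stable_imp_charpoly_neg_one_pos) auto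
  moreover have "1 + (?J$1$1 + ?J$2$2) + det ?J =
      2 * (1 + q + 2 * q\<^sup>2 - k * q * (1 + 3 * q - 2 * q\<^sup>2)) / (1 + q)"
  proof -
    have "1 + q \<noteq> 0" using q by simp
    then show ?thesis
      unfolding GL_jacobian(2) det_2 by (simp add: divide_simps) algebra
  qed
  ultimately show ?thesis using q by (simp add: zero_less_divide_iff)
qed

text \<open>The hypothesis is positivity of the characteristic polynomial at -1. The other two Jury
  conditions follow: the value at 1 is \<open>k * q * (3 - 2 * q)\<close> plus a nonnegative
  determinant, and the determinant is below 1 by the hypothesis itself.\<close>

lemma GB_stable:
  assumes "k * q * (1 + 4 * q - 4 * q\<^sup>2) < 1 + 2 * q"
  shows "locally_stable_at (GB_map c1 c2 \<delta>) E"
proof -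
  let ?J = "jacobian (GB_map c1 c2 \<delta>) (at E)"
  have nz: "1 + 2 * q \<noteq> 0" "1 - q \<noteq> 0" using q by auto
  have kq: "k * q > 0" using q s \<delta> by simp
  have tr: "?J$1$1 + ?J$2$2 = 1 - k * q * (3 - 2 * q)"
    unfolding GB_jacobian(2) by simp
  have det: "det ?J = k * q * (1 - 2 * q)\<^sup>2 / (1 + 2 * q)"
    unfolding GB_jacobian(2) det_2 using nz by (simp add: divide_simps) algebra
  have "norm z < 1" if "eigenvalue (map_matrix complex_of_real ?J) z" for z
  proof (rule Jury_criterion_2x2[OF _ _ _ that])
    have "1 + (?J$1$1 + ?J$2$2) + det ?J =
        2 * (1 + 2 * q - k * q * (1 + 4 * q - 4 * q\<^sup>2)) / (1 + 2 * q)"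
      unfolding tr det using nz by (simp add: divide_simps) algebra
    also have "\<dots> > 0" using assms q by simp
    finally show "1 + (?J$1$1 + ?J$2$2) + det ?J > 0" .
    have "det ?J \<ge> 0" unfolding det using kq q s \<delta>
      by (intro divide_nonneg_pos mult_nonneg_nonneg) auto
    moreover have "k * q * (3 - 2 * q) > 0" using q by (intro mult_pos_pos[OF kq]) simp
    ultimately show "1 - (?J$1$1 + ?J$2$2) + det ?J > 0" unfolding tr by linarith
    \<comment> \<open>The difference of the two sides is \<open>8 * q * (1 - q)\<close>. So the
      numerator of the determinant is at most the left side of the assumed bound.\<close>
    have "(1 - 2 * q)\<^sup>2 \<le> 1 + 4 * q - 4 * q\<^sup>2"
      using q mult_left_mono[of q 1 q] by (simp add: power2_eq_square algebra_simps)
    then have "k * q * (1 - 2 * q)\<^sup>2 \<le> k * q * (1 + 4 * q - 4 * q\<^sup>2)"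
      using kq by (intro mult_left_mono) auto
    also note assms
    finally show "det ?J < 1"
      unfolding det by (subst divide_less_eq_1_pos) (use q in simp_all)
  qed
  then show ?thesis
    using GB_jacobian(1) by (simp add: locally_stable_at_def)
qed

text \<open>The two upper bounds on \<open>k * q\<close> are compared after cross-multiplication;
  the positive factor \<open>1 + q + 2 * q^2\<close> is cancelled at the end.\<close>

lemma GL_stable_imp_GB_stable:
  assumes "locally_stable_at (GL_map c1 c2 \<delta>) E"
  shows "locally_stable_at (GB_map c1 c2 \<delta>) E"
proof (rule GB_stable)
  have GL: "k * q * (1 + 3 * q - 2 * q\<^sup>2) < 1 + q + 2 * q\<^sup>2"
    using assms by (rule GL_stable_imp)
  have q2: "q\<^sup>2 \<le> q" using q by (simp add: power2_eq_square mult_left_le)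
  have "k * q * (1 + 4 * q - 4 * q\<^sup>2) * (1 + q + 2 * q\<^sup>2) \<le>
      k * q * ((1 + 2 * q) * (1 + 3 * q - 2 * q\<^sup>2))"
  proof -
    have "(1 + 2 * q) * (1 + 3 * q - 2 * q\<^sup>2) - (1 + q + 2 * q\<^sup>2) * (1 + 4 * q - 4 * q\<^sup>2)
        = 2 * (q * (1 - 2 * q))\<^sup>2" by algebra
    also have "\<dots> \<ge> 0" by simp
    finally have "k * q * ((1 + q + 2 * q\<^sup>2) * (1 + 4 * q - 4 * q\<^sup>2)) \<le>
        k * q * ((1 + 2 * q) * (1 + 3 * q - 2 * q\<^sup>2))"
      using q s \<delta> by (intro mult_left_mono) auto
    then show ?thesis by (simp add: mult_ac)
  qed
  also have "\<dots> < (1 + 2 * q) * (1 + q + 2 * q\<^sup>2)"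
    using mult_strict_left_mono[OF GL, of "1 + 2 * q"] q by (simp add: mult_ac)
  finally show "k * q * (1 + 4 * q - 4 * q\<^sup>2) < 1 + 2 * q"
    by (rule mult_right_less_imp_less) (use q in simp)
qed

end

theorem proposition3:
  shows "Omega_GL \<subset> Omega_GB"
proof (rule psubsetI)
  show "Omega_GL \<subseteq> Omega_GB"
  proof (clarify)
    fix c1 c2 \<delta> assume GL: "(c1, c2, \<delta>) \<in> Omega_GL"
    then have pos: "c1 > 0" "c2 > 0" "\<delta> > 0" by (auto simp: Omega_GL_def)
    obtain q s where "0 < q" "q < 1" "0 < s"
      "c1 = q / (2 * (1 - q) * s\<^sup>2)" "c2 = (1 - q) / (2 * q * s\<^sup>2)"
      using equilibrium_equations_parametrization[OF pos(1,2)] .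
    then interpret equilibrium c1 c2 q s \<delta>
      using pos by unfold_locales
    show "(c1, c2, \<delta>) \<in> Omega_GB"
      using GL GL_stable_imp_GB_stable
      by (simp add: Omega_GL_def Omega_GB_def positive_equilibrium_eq)
  qed
next
  \<comment> \<open>At \<open>q = 2/3\<close> the bounds on \<open>k\<close> are \<open>69/38\<close> for GL and \<open>63/34\<close> for GB;
    \<open>s = 1/2\<close> and \<open>\<delta> = 11/12\<close> give \<open>k = 11/6\<close>, which lies between them.\<close>
  interpret equilibrium 4 1 "2/3" "1/2" "11/12"
    by unfold_locales (simp_all add: power2_eq_square)
  have "\<not> locally_stable_at (GL_map 4 1 (11/12)) E"
    using GL_stable_imp by (auto simp: power2_eq_square)
  moreover have "locally_stable_at (GB_map 4 1 (11/12)) E"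
    by (rule GB_stable) (simp add: power2_eq_square)
  ultimately have "(4, 1, 11/12) \<in> Omega_GB - Omega_GL"
    by (simp add: Omega_GL_def Omega_GB_def positive_equilibrium_eq)
  then show "Omega_GL \<noteq> Omega_GB" by blast
qed

end
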